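(* Let $X=\mathbb N$ be countably infinite and let $\mathfrak c = 2^{\aleph_0}$. Then there are $2^{\mathfrak c}$ clones on $X$ containing the monoid $X^X$ of all unary operations on $X$.
   Context: An operation on $X$ is a function $f:X^n\to X$ for some positive natural number $n$. A clone on $X$ is a set of operations on $X$ that contains all projection functions and is closed under composition. *)

theory Defs
  imports Main "HOL-Library.FuncSet" "HOL-Library.Equipollence"
begin

text \<open>The set \<open>X\<close> is the universe of the type \<open>'a\<close>, and \<open>X\<^sup>n\<close> is the set of lists of length \<open>n\<close>.\<close>

definition tuples :: "nat \<Rightarrow> 'a list set" where
  "tuples n = {xs. length xs = n}"

text \<open>
  An operation is a pair of its arity \<open>n > 0\<close> and a function that is extensional on \<open>X\<^sup>n\<close>.
  Extensionality makes the representing function unique. The arity is recorded explicitly because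
  it cannot be recovered from an extensional function that takes only the value \<open>undefined\<close>.
\<close>

type_synonym 'a operation = "nat \<times> ('a list \<Rightarrow> 'a)"

definition operations_of_arity :: "nat \<Rightarrow> 'a operation set" where
  "operations_of_arity n = {n} \<times> (tuples n \<rightarrow>\<^sub>E UNIV)"

definition operations :: "'a operation set" where
  "operations = (\<Union>n\<in>{1..}. operations_of_arity n)"

definition projection :: "nat \<Rightarrow> nat \<Rightarrow> 'a operation" where
  "projection n i = (n, \<lambda>xs\<in>tuples n. xs ! i)"

text \<open>
  The \<open>m\<close>-ary operation mapping \<open>x\<close> to \<open>f (g\<^sub>1 x, \<dots>, g\<^sub>n x)\<close>, where \<open>gs\<close> lists
  \<open>g\<^sub>1, \<dots>, g\<^sub>n\<close>, all of them \<open>m\<close>-ary.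
\<close>

definition compose_op :: "nat \<Rightarrow> ('a list \<Rightarrow> 'a) \<Rightarrow> ('a list \<Rightarrow> 'a) list \<Rightarrow> 'a operation" where
  "compose_op m f gs = (m, \<lambda>xs\<in>tuples m. f (map (\<lambda>g. g xs) gs))"

definition clone :: "'a operation set \<Rightarrow> bool" where
  "clone C \<longleftrightarrow>
     C \<subseteq> operations \<and>
     (\<forall>n i. i < n \<longrightarrow> projection n i \<in> C) \<and>
     (\<forall>n m f gs. (n, f) \<in> C \<longrightarrow> length gs = n \<longrightarrow> (\<forall>g\<in>set gs. (m, g) \<in> C)
        \<longrightarrow> compose_op m f gs \<in> C)"

end

theory Submission
  imports Defs
begin

text \<open>
  There are only \<open>2 ^ \<aleph>\<^sub>0\<close> operations on a countable set, which gives the upper bound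
  (\<open>operations_lepoll\<close>). For the lower bound, it suffices to find continuum many operations
  \<open>f\<^sub>r\<close> and, for every set \<open>J\<close> of indices, a clone above the unary operations containing
  exactly those \<open>f\<^sub>r\<close> with \<open>r \<in> J\<close>.

  The clones are defined by growth. Applying a unary operation never increases the size of a set,
  so all unary operations satisfy any condition that bounds the number of values of an \<open>m\<close>-ary
  operation on \<open>S\<^sup>m\<close> by something that is at least \<open>card S\<close>. Fix a sequence \<open>s\<close> of
  sizes (scales) and a set \<open>Z\<close> of exceptional indices. The operations that take \<open>O (s n)\<close> values on
  sets of size \<open>O (s n)\<close>, for \<open>n\<close> outside \<open>Z\<close>, are closed under composition
  (\<open>bounded_growth_compose_op\<close>), and so are the unions of such classes over a family of
  sets \<open>Z\<close> that is closed under binary unions (\<open>clone_growth_clone\<close>).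

  What remains is an operation that grows faster at the scales \<open>s n\<close> with \<open>n\<close> in a given set \<open>Z\<close>, but not
  at the other scales. A graph turns into a binary operation that is injective on the edges and
  constant on all other pairs; the number of values on a set of vertices is then, up to one, the number of
  edges that it spans. So the scale \<open>s n\<close> calls for a graph with \<open>s n\<close> vertices and average degree at
  least \<open>n\<close>, in which all much smaller sets of vertices span only linearly many edges. Regular
  graphs of large degree without short cycles have this property. They are constructed by a double
  induction in \<open>exists_regular_locally_sparse_pow2\<close>. If the parameters of these graphs grow
  fast enough (\<open>exists_sparse_blocks\<close>), the disjoint union of the graphs with index in \<open>Z\<close> gives an
  operation that satisfies the growth condition outside \<open>Z\<close> (\<open>bounded_growth_edge_op\<close>) but violates it
  outside every \<open>Y\<close> for which \<open>Z - Y\<close> is infinite (\<open>unbounded_growth_edge_op\<close>).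

  Finally let \<open>Z\<close> range over an almost disjoint family of continuum many infinite sets of numbers. For
  a set \<open>J\<close> of members of the family, take as exceptional sets all finite unions of members of \<open>J\<close>. A
  member outside \<open>J\<close> is not almost covered by such a union, so its operation is not in the clone.
\<close>

section \<open>Regular graphs without short cycles\<close>

text \<open>
  A graph is a symmetric irreflexive relation, so every edge is counted twice in \<open>card E\<close>.
\<close>

definition regular_graph :: "nat \<Rightarrow> 'v set \<Rightarrow> ('v \<times> 'v) set \<Rightarrow> bool" where
  "regular_graph d V E \<longleftrightarrow>
     finite V \<and> V \<noteq> {} \<and> E \<subseteq> V \<times> V \<and> sym E \<and> irrefl E \<and> (\<forall>v\<in>V. card (E `` {v}) = d)"

text \<open>
  Since edges are counted twice, the inequality says that a nonempty set of at most \<open>t\<close> vertices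
  spans fewer edges than it has vertices. Equivalently, the graph has no cycle of length at most
  \<open>t\<close>; in the counting form, the bounds for disjoint pieces of a vertex set can simply be added.
\<close>

definition locally_sparse :: "nat \<Rightarrow> ('v \<times> 'v) set \<Rightarrow> bool" where
  "locally_sparse t E \<longleftrightarrow>
     (\<forall>S. finite S \<longrightarrow> S \<noteq> {} \<longrightarrow> card S \<le> t \<longrightarrow> card (E \<inter> S \<times> S) + 2 \<le> 2 * card S)"

lemma locally_sparseD:
  "locally_sparse t E \<Longrightarrow> finite S \<Longrightarrow> S \<noteq> {} \<Longrightarrow> card S \<le> t \<Longrightarrow>
     card (E \<inter> S \<times> S) + 2 \<le> 2 * card S"
  unfolding locally_sparse_def by blast

lemma card_edges_regular_graph:
  assumes "regular_graph d V E"
  shows "finite E" and "card E = d * card V"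
proof -
  have V: "finite V" "E \<subseteq> V \<times> V" "\<forall>v\<in>V. card (E `` {v}) = d"
    using assms unfolding regular_graph_def by auto
  then show fE: "finite E"
    using finite_subset by blast
  have "E = Sigma V (\<lambda>v. E `` {v})"
    using V by auto
  then have "card E = card (Sigma V (\<lambda>v. E `` {v}))"
    by (rule arg_cong)
  also have "\<dots> = (\<Sum>v\<in>V. card (E `` {v}))"
    using V(1) fE by (intro card_SigmaI) (auto intro: finite_Image)
  finally have "card E = (\<Sum>v\<in>V. card (E `` {v}))" .
  then show "card E = d * card V"
    using V by simp
qed

lemma degree_le_card_vertices:
  assumes "regular_graph d V E"
  shows "d \<le> card V" and "0 < card V"
proof -
  have V: "finite V" "V \<noteq> {}" "E \<subseteq> V \<times> V" "\<forall>v\<in>V. card (E `` {v}) = d"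
    using assms unfolding regular_graph_def by auto
  then obtain v where "v \<in> V" by blast
  then show "d \<le> card V"
    using V card_mono[of V "E `` {v}"] by auto
  show "0 < card V"
    using V by (simp add: card_gt_0_iff)
qed

text \<open>
  A vertex of degree at most one in the graph induced on \<open>S\<close> can be removed: this lowers the number of
  vertices by one and the number of edges by at most one. So only the sets that induce minimum
  degree two have to be examined.
\<close>

lemma locally_sparseI_min_degree:
  fixes E :: "('v \<times> 'v) set"
  assumes "sym E" and "irrefl E"
    and dense: "\<And>S. finite S \<Longrightarrow> S \<noteq> {} \<Longrightarrow> card S \<le> t \<Longrightarrow>
       (\<And>x. x \<in> S \<Longrightarrow> 2 \<le> card (E `` {x} \<inter> S)) \<Longrightarrow> card (E \<inter> S \<times> S) + 2 \<le> 2 * card S"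
  shows "locally_sparse t E"
proof -
  have "card (E \<inter> S \<times> S) + 2 \<le> 2 * card S" if "finite S" "S \<noteq> {}" "card S \<le> t" for S
    using that
  proof (induction S rule: finite_psubset_induct)
    case (psubset S)
    show ?case
    proof (cases "\<forall>x\<in>S. 2 \<le> card (E `` {x} \<inter> S)")
      case True
      then show ?thesis using dense psubset by blast
    next
      case False
      then obtain x where x: "x \<in> S" "card (E `` {x} \<inter> S) \<le> 1" by auto
      define N where "N = E `` {x} \<inter> S"
      have N: "finite N" "card N \<le> 1"
        using x psubset.hyps by (auto simp: N_def)
      define R where "R = S - {x}"
      show ?thesis
      proof (cases "R = {}")
        case True
        then have "S = {x}" using x unfolding R_def by auto
        moreover have "E \<inter> S \<times> S = {}"
          using \<open>irrefl E\<close> unfolding irrefl_def \<open>S = {x}\<close> by auto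
        ultimately show ?thesis by simp
      next
        case False
        have cR: "card S = Suc (card R)" "finite R"
          using card_Suc_Diff1[OF psubset.hyps(1) x(1)] psubset.hyps unfolding R_def by simp_all
        have IH: "card (E \<inter> R \<times> R) + 2 \<le> 2 * card R"
        proof (rule psubset.IH)
          show "R \<subset> S" using x(1) unfolding R_def by blast
          show "R \<noteq> {}" by fact
          show "card R \<le> t" using psubset.prems(2) cR by linarith
        qed
        have "E \<inter> S \<times> S \<subseteq> (E \<inter> R \<times> R) \<union> ({x} \<times> N \<union> N \<times> {x})"
          using \<open>sym E\<close> unfolding N_def R_def by (auto dest: symD)
        then have "card (E \<inter> S \<times> S) \<le> card ((E \<inter> R \<times> R) \<union> ({x} \<times> N \<union> N \<times> {x}))"
          by (rule card_mono[rotated]) (use N cR in auto)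
        also have "\<dots> \<le> card (E \<inter> R \<times> R) + (card ({x} \<times> N) + card (N \<times> {x}))"
          by (meson add_left_mono card_Un_le le_trans)
        also have "\<dots> \<le> card (E \<inter> R \<times> R) + 2"
          using N by simp
        finally show ?thesis using IH cR by simp
      qed
    qed
  qed
  then show ?thesis unfolding locally_sparse_def by blast
qed

text \<open>
  The degree is raised by one without creating short cycles: take a copy of the graph on \<open>V\<close> for each
  vertex \<open>w\<close> of \<open>H\<close>, and for each edge of \<open>H\<close> join the two corresponding copies by one edge. As \<open>H\<close>
  has degree \<open>card V\<close>, the new edges can be attached such that every vertex receives exactly one.
  A set \<open>S\<close> of minimum degree two meets every copy that it meets at all in at least two vertices,
  because one of the two neighbours of a vertex lies in the same copy. Hence \<open>S\<close> meets at most
  \<open>card S div 2\<close> copies, so \<open>H\<close> only has to be sparse for sets of half the size. The new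
  edges inside \<open>S\<close> are fewer than the copies met, and in each copy the old edges are fewer
  than the vertices; adding these bounds gives the claim.
\<close>

lemma locally_sparse_lift:
  fixes E :: "('v \<times> 'v) set" and H :: "('w \<times> 'w) set"
  assumes E: "regular_graph d V E" "locally_sparse t E"
    and H: "regular_graph (card V) W H" "locally_sparse u H"
    and t: "t \<le> 2 * u"
  shows "\<exists>E'. regular_graph (Suc d) (W \<times> V) E' \<and> locally_sparse t E'"
proof -
  have EV: "finite V" "V \<noteq> {}" "E \<subseteq> V \<times> V" "sym E" "irrefl E"
      "\<And>v. v \<in> V \<Longrightarrow> card (E `` {v}) = d"
    using E unfolding regular_graph_def by auto
  have HW: "finite W" "W \<noteq> {}" "H \<subseteq> W \<times> W" "sym H" "irrefl H"
      "\<And>w. w \<in> W \<Longrightarrow> card (H `` {w}) = card V"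
    using H unfolding regular_graph_def by auto
  have "\<exists>p. bij_betw p (H `` {w}) V" if "w \<in> W" for w
  proof -
    have "finite (H `` {w})"
      using HW by (meson finite_SigmaI finite_subset finite_Image)
    then show ?thesis
      using HW(6)[OF that] EV(1) finite_same_card_bij by blast
  qed
  \<comment> \<open>\<open>port w w'\<close> is the vertex of the copy \<open>w\<close> at which the edge towards the copy \<open>w'\<close> is attached.\<close>
  then obtain port where port: "\<And>w. w \<in> W \<Longrightarrow> bij_betw (port w) (H `` {w}) V"
    by metis
  define C where "C = {((w, port w w'), (w', port w' w)) | w w'. (w, w') \<in> H}"
  define D where "D = {((w, v), (w, v')) | w v v'. w \<in> W \<and> (v, v') \<in> E}"
  have port_in: "port w w' \<in> V" if "(w, w') \<in> H" for w w'
    using port[of w] that HW(3) by (auto simp: bij_betw_def)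
  have symH: "(w', w) \<in> H" if "(w, w') \<in> H" for w w'
    using that HW(4) by (auto dest: symD)
  have port_inj: "w' = w''" if "(w, w') \<in> H" "(w, w'') \<in> H" "port w w' = port w w''" for w w' w''
    using port[of w] that HW(3) by (auto simp: bij_betw_def dest: inj_onD)
  have sub: "C \<union> D \<subseteq> (W \<times> V) \<times> (W \<times> V)"
    using EV(3) HW(3) port_in symH unfolding C_def D_def by blast
  have sym: "sym (C \<union> D)"
    using EV(4) symH unfolding C_def D_def sym_def by blast
  have irr: "irrefl (C \<union> D)"
    using EV(5) HW(5) unfolding C_def D_def irrefl_def by blast
  have cross: "\<exists>z. C `` {(w, v)} = {z} \<and> fst z \<noteq> w" if "w \<in> W" "v \<in> V" for w v
  proof -
    have "v \<in> port w ` (H `` {w})"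
      using port[OF that(1)] that(2) by (auto simp: bij_betw_def)
    then obtain w' where w': "(w, w') \<in> H" "port w w' = v"
      by auto
    then have "C `` {(w, v)} = {(w', port w' w)}"
      using port_inj unfolding C_def by blast
    moreover have "w' \<noteq> w"
      using w' HW(5) by (auto simp: irrefl_def)
    ultimately show ?thesis by auto
  qed
  have "card ((C \<union> D) `` {x}) = Suc d" if x_in: "x \<in> W \<times> V" for x
  proof -
    obtain w v where x: "x = (w, v)" "w \<in> W" "v \<in> V"
      using x_in by blast
    obtain z where z: "C `` {(w, v)} = {z}" "fst z \<noteq> w"
      using cross x by blast
    have D: "D `` {(w, v)} = Pair w ` (E `` {v})"
      using x unfolding D_def by auto
    have "card (D `` {(w, v)}) = d"
      unfolding D using EV(6)[OF x(3)] by (simp add: card_image inj_on_def)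
    moreover have "finite (D `` {(w, v)})"
      unfolding D using EV by (meson finite_Image finite_SigmaI finite_imageI finite_subset)
    moreover have "z \<notin> D `` {(w, v)}"
      using z(2) unfolding D by auto
    moreover have "(C \<union> D) `` {x} = insert z (D `` {(w, v)})"
      using z x by auto
    ultimately show ?thesis by simp
  qed
  then have "regular_graph (Suc d) (W \<times> V) (C \<union> D)"
    using sub sym irr EV HW unfolding regular_graph_def by auto
  moreover have "locally_sparse t (C \<union> D)"
  proof (rule locally_sparseI_min_degree[OF sym irr])
    fix S :: "('w \<times> 'v) set"
    assume S: "finite S" "S \<noteq> {}" "card S \<le> t"
      and deg: "\<And>x. x \<in> S \<Longrightarrow> 2 \<le> card ((C \<union> D) `` {x} \<inter> S)"
    define P where "P = fst ` S"
    define slice where "slice w = S `` {w}" for w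
    have P: "finite P" "P \<noteq> {}" and fin_slice: "finite (slice w)" for w
      using S unfolding P_def slice_def by auto
    have S_eq: "S = Sigma P slice"
      unfolding P_def slice_def by (auto intro: rev_image_eqI)
    have card_S: "card S = (\<Sum>w\<in>P. card (slice w))"
      unfolding S_eq using P fin_slice by simp
    \<comment> \<open>A vertex has only one edge leaving its copy, so its second neighbour in \<open>S\<close> is in its slice.\<close>
    have two: "2 \<le> card (slice w)" and ne: "slice w \<noteq> {}" if w_in: "w \<in> P" for w
    proof -
      obtain v where v: "(w, v) \<in> S"
        using w_in unfolding P_def by auto
      then show "slice w \<noteq> {}" unfolding slice_def by auto
      have "(w, v) \<in> W \<times> V"
        using deg[OF v] sub by (cases "(C \<union> D) `` {(w, v)} = {}") auto
      then obtain z where z: "C `` {(w, v)} = {z}"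
        using cross by blast
      show "2 \<le> card (slice w)"
      proof (rule ccontr)
        assume "\<not> 2 \<le> card (slice w)"
        then have "card (slice w) \<le> Suc 0" by simp
        moreover have "v \<in> slice w" using v unfolding slice_def by simp
        ultimately have "slice w \<subseteq> {v}"
          using fin_slice card_le_Suc0_iff_eq by blast
        then have "D `` {(w, v)} \<inter> S = {}"
          using EV(5) unfolding D_def slice_def irrefl_def by blast
        then have "(C \<union> D) `` {(w, v)} \<inter> S \<subseteq> {z}"
          using z by auto
        then have "card ((C \<union> D) `` {(w, v)} \<inter> S) \<le> card {z}"
          by (rule card_mono[rotated]) simp
        then show False using deg[OF v] by simp
      qed
    qed
    have "2 * card P \<le> card S"
      unfolding card_S using sum_mono[OF two, of P "\<lambda>w. w"] by simp
    then have P_sparse: "card (H \<inter> P \<times> P) + 2 \<le> 2 * card P"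
      using locally_sparseD[OF H(2) P] S(3) t by linarith
    have slice_sparse: "card (E \<inter> slice w \<times> slice w) + 2 \<le> 2 * card (slice w)" if "w \<in> P" for w
    proof (rule locally_sparseD[OF E(2) fin_slice ne[OF that]])
      have "card (slice w) \<le> card S"
        unfolding card_S using member_le_sum[OF that, of "\<lambda>w. card (slice w)"] P by simp
      then show "card (slice w) \<le> t" using S by simp
    qed
    \<comment> \<open>\<open>C\<close> and \<open>D\<close> restricted to \<open>S\<close>, parametrised by edges of \<open>H\<close> and of the slices.\<close>
    let ?cross = "(\<lambda>(w, w'). ((w, port w w'), (w', port w' w))) ` (H \<inter> P \<times> P)"
    let ?inner = "(\<lambda>(w, (v, v')). ((w, v), (w, v'))) ` Sigma P (\<lambda>w. E \<inter> slice w \<times> slice w)"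
    have fin: "finite (H \<inter> P \<times> P)" "finite (Sigma P (\<lambda>w. E \<inter> slice w \<times> slice w))"
      using P fin_slice by auto
    have "C \<inter> S \<times> S \<subseteq> ?cross"
      unfolding C_def P_def by force
    moreover have "D \<inter> S \<times> S \<subseteq> ?inner"
      unfolding D_def P_def slice_def by force
    ultimately have "(C \<union> D) \<inter> S \<times> S \<subseteq> ?cross \<union> ?inner"
      by blast
    then have "card ((C \<union> D) \<inter> S \<times> S) \<le> card (?cross \<union> ?inner)"
      by (rule card_mono[rotated]) (use fin in blast)
    also have "\<dots> \<le> card ?cross + card ?inner"
      by (rule card_Un_le)
    also have "\<dots> \<le> card (H \<inter> P \<times> P) + card (Sigma P (\<lambda>w. E \<inter> slice w \<times> slice w))"
      by (intro add_mono card_image_le fin)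
    also have "card (Sigma P (\<lambda>w. E \<inter> slice w \<times> slice w)) =
        (\<Sum>w\<in>P. card (E \<inter> slice w \<times> slice w))"
      using P fin_slice by simp
    finally have "card ((C \<union> D) \<inter> S \<times> S) \<le>
        card (H \<inter> P \<times> P) + (\<Sum>w\<in>P. card (E \<inter> slice w \<times> slice w))" .
    moreover have "(\<Sum>w\<in>P. card (E \<inter> slice w \<times> slice w) + 2) \<le> (\<Sum>w\<in>P. 2 * card (slice w))"
      using slice_sparse by (rule sum_mono)
    then have "(\<Sum>w\<in>P. card (E \<inter> slice w \<times> slice w)) + 2 * card P \<le> 2 * card S"
      unfolding card_S sum.distrib sum_distrib_left by simp
    ultimately show "card ((C \<union> D) \<inter> S \<times> S) + 2 \<le> 2 * card S"
      using P_sparse by linarith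
  qed
  ultimately show ?thesis by blast
qed

lemma locally_sparse_rename:
  fixes h :: "'v \<Rightarrow> 'w"
  assumes "inj h" and G: "regular_graph d V E" "locally_sparse t E"
  shows "regular_graph d (h ` V) (map_prod h h ` E)" and "locally_sparse t (map_prod h h ` E)"
proof -
  have V: "finite V" "V \<noteq> {}" "E \<subseteq> V \<times> V" "sym E" "irrefl E" "\<forall>v\<in>V. card (E `` {v}) = d"
    using G unfolding regular_graph_def by auto
  have inj: "h x = h y \<longleftrightarrow> x = y" for x y
    using \<open>inj h\<close> by (auto dest: injD)
  have "(map_prod h h ` E) `` {h v} = h ` (E `` {v})" for v
    using inj by (force simp: image_iff)
  then have "card ((map_prod h h ` E) `` {h v}) = card (E `` {v})" for v
    using \<open>inj h\<close> by (simp add: card_image inj_on_subset)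
  moreover have "sym (map_prod h h ` E)"
    using V(4) unfolding sym_def by force
  moreover have "irrefl (map_prod h h ` E)"
    using V(5) inj unfolding irrefl_def by force
  ultimately show "regular_graph d (h ` V) (map_prod h h ` E)"
    using V unfolding regular_graph_def by auto
  show "locally_sparse t (map_prod h h ` E)"
    unfolding locally_sparse_def
  proof (intro allI impI)
    fix S :: "'w set"
    assume S: "finite S" "S \<noteq> {}" "card S \<le> t"
    let ?T = "h -` S"
    have T: "finite ?T" "card ?T \<le> card S"
      using S \<open>inj h\<close> card_vimage_inj_on_le[of h UNIV S] by (simp_all add: finite_vimageI)
    have eq: "map_prod h h ` E \<inter> S \<times> S = map_prod h h ` (E \<inter> ?T \<times> ?T)"
      by force
    have le: "card (map_prod h h ` E \<inter> S \<times> S) \<le> card (E \<inter> ?T \<times> ?T)"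
      unfolding eq using T by (intro card_image_le) auto
    show "card (map_prod h h ` E \<inter> S \<times> S) + 2 \<le> 2 * card S"
    proof (cases "?T = {}")
      case True
      then have "card (map_prod h h ` E \<inter> S \<times> S) = 0" using le by simp
      moreover have "0 < card S" using S by (simp add: card_gt_0_iff)
      ultimately show ?thesis by simp
    next
      case False
      then show ?thesis
        using le locally_sparseD[OF G(2) T(1) False] T(2) S(3) by linarith
    qed
  qed
qed

text \<open>
  For fixed \<open>j\<close>, the degree is raised step by step with \<open>locally_sparse_lift\<close>. The graph \<open>H\<close> needed there
  may have a huge degree, but only has to be sparse up to \<open>2 ^ j\<close>; so the outer induction, on \<open>j\<close>,
  supplies it. For \<open>j = 0\<close> sparsity is no restriction, and a complete graph will do.
\<close>

lemma exists_regular_locally_sparse_pow2: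
  "\<exists>(V :: nat set) E. regular_graph d V E \<and> locally_sparse (2 ^ j) E"
proof (induction j arbitrary: d)
  case 0
  let ?V = "{..d}" and ?E = "{..d} \<times> {..d} - Id"
  have "?E `` {v} = ?V - {v}" if "v \<in> ?V" for v
    using that by auto
  then have "regular_graph d ?V ?E"
    unfolding regular_graph_def by (auto simp: sym_def irrefl_def)
  moreover have "locally_sparse 1 ?E"
    unfolding locally_sparse_def
  proof (intro allI impI)
    fix S :: "nat set" assume "finite S" "S \<noteq> {}" "card S \<le> 1"
    then have "card S = 1" by (metis card_0_eq le_antisym less_one not_le)
    then obtain x where "S = {x}" by (auto simp: card_1_singleton_iff)
    then have "?E \<inter> S \<times> S = {}" by auto
    then show "card (?E \<inter> S \<times> S) + 2 \<le> 2 * card S"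
      using \<open>card S = 1\<close> by simp
  qed
  ultimately show ?case by auto
next
  case (Suc j)
  have lvl: "\<exists>(V :: nat set) E. regular_graph n V E \<and> locally_sparse (2 ^ j) E" for n
    by (rule Suc)
  show ?case
  proof (induction d)
    case 0
    have "regular_graph 0 {0::nat} {}"
      unfolding regular_graph_def by (auto simp: sym_def irrefl_def)
    moreover have "locally_sparse (2 ^ Suc j) ({} :: (nat \<times> nat) set)"
      unfolding locally_sparse_def
    proof (intro allI impI)
      fix S :: "nat set" assume "finite S" "S \<noteq> {}"
      then have "0 < card S" by (simp add: card_gt_0_iff)
      then show "card ({} \<inter> S \<times> S) + 2 \<le> 2 * card S" by simp
    qed
    ultimately show ?case by blast
  next
    case (Suc d)
    then obtain V :: "nat set" and E
      where G: "regular_graph d V E" "locally_sparse (2 ^ Suc j) E" by blast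
    obtain W :: "nat set" and H
      where H: "regular_graph (card V) W H" "locally_sparse (2 ^ j) H" using lvl by blast
    obtain E' where "regular_graph (Suc d) (W \<times> V) E'" "locally_sparse (2 ^ Suc j) E'"
      using locally_sparse_lift[OF G H] by auto
    then show ?case
      using locally_sparse_rename[OF inj_prod_encode] by blast
  qed
qed

lemma exists_regular_locally_sparse:
  "\<exists>(V :: nat set) E. regular_graph d V E \<and> locally_sparse t E"
proof -
  obtain V :: "nat set" and E where G: "regular_graph d V E" "locally_sparse (2 ^ t) E"
    using exists_regular_locally_sparse_pow2 by blast
  have "t \<le> 2 ^ t" by (rule less_imp_le[OF less_exp])
  then have "locally_sparse t E"
    unfolding locally_sparse_def using locally_sparseD[OF G(2)] le_trans by blast
  then show ?thesis using G(1) by blast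
qed


section \<open>Clones of operations of bounded growth\<close>

definition values_on :: "'a operation \<Rightarrow> 'a set \<Rightarrow> 'a set" where
  "values_on p S = snd p ` {xs \<in> tuples (fst p). set xs \<subseteq> S}"

text \<open>
  With \<open>\<kappa> (k)\<close> for the largest number of values of the operation on a set of at most \<open>k\<close> elements, this
  says that \<open>\<kappa> (l * s n)\<close> is \<open>O (s n)\<close> for each \<open>l\<close>, where \<open>n\<close> ranges over the complement of \<open>Z\<close>. The
  factor \<open>l\<close> makes the condition stable under composition.
\<close>

definition bounded_growth :: "(nat \<Rightarrow> nat) \<Rightarrow> nat set \<Rightarrow> 'a operation \<Rightarrow> bool" where
  "bounded_growth s Z p \<longleftrightarrow>
     (\<forall>l. \<exists>K. \<forall>n S. n \<notin> Z \<longrightarrow> finite S \<longrightarrow> card S \<le> l * s n \<longrightarrow> card (values_on p S) \<le> K * s n)"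

definition growth_clone :: "(nat \<Rightarrow> nat) \<Rightarrow> nat set set \<Rightarrow> 'a operation set" where
  "growth_clone s \<Z> = {p \<in> operations. \<exists>Z\<in>\<Z>. bounded_growth s Z p}"

lemma finite_values_on: "finite S \<Longrightarrow> finite (values_on p S)"
  unfolding values_on_def tuples_def
  by (rule finite_imageI, rule finite_subset[OF _ finite_lists_length_eq[of S "fst p"]]) auto

lemma bounded_growthI_card_le:
  assumes "\<And>S. finite S \<Longrightarrow> card (values_on p S) \<le> card S"
  shows "bounded_growth s Z p"
  unfolding bounded_growth_def using assms le_trans by metis

lemma bounded_growth_mono: "bounded_growth s Y p \<Longrightarrow> Y \<subseteq> Z \<Longrightarrow> bounded_growth s Z p"
  unfolding bounded_growth_def by (metis subsetD)

lemma bounded_growth_unary: "bounded_growth s Z (1, f)"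
proof (rule bounded_growthI_card_le)
  fix S :: "'a set" assume "finite S"
  have "values_on (1, f) S \<subseteq> (\<lambda>x. f [x]) ` S"
    unfolding values_on_def tuples_def by (auto simp: length_Suc_conv)
  then show "card (values_on (1, f) S) \<le> card S"
    using \<open>finite S\<close> surj_card_le by blast
qed

lemma bounded_growth_projection:
  assumes "i < n"
  shows "bounded_growth s Z (projection n i)"
proof (rule bounded_growthI_card_le)
  fix S :: "'a set" assume "finite S"
  moreover have "values_on (projection n i) S \<subseteq> S"
    using assms unfolding values_on_def projection_def tuples_def by (auto dest: nth_mem)
  ultimately show "card (values_on (projection n i) S) \<le> card S"
    by (rule card_mono)
qed

lemma values_on_compose_op:
  "values_on (compose_op m f gs) S \<subseteq>
     values_on (length gs, f) (\<Union>g\<in>set gs. values_on (m, g) S)"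
  unfolding values_on_def compose_op_def tuples_def by fastforce

text \<open>
  On a set of size \<open>O (s n)\<close> each inner operation takes \<open>O (s n)\<close> values, so all of them together
  take their values in a set of size \<open>O (s n)\<close>, to which the condition on \<open>f\<close> applies.
\<close>

lemma bounded_growth_compose_op:
  assumes f: "bounded_growth s Z (length gs, f)"
    and gs: "\<forall>g\<in>set gs. bounded_growth s Z (m, g)"
  shows "bounded_growth s Z (compose_op m f gs)"
  unfolding bounded_growth_def
proof
  fix l
  have "\<forall>g\<in>set gs. \<exists>K. \<forall>n S. n \<notin> Z \<longrightarrow> finite S \<longrightarrow> card S \<le> l * s n \<longrightarrow>
      card (values_on (m, g) S) \<le> K * s n"
    using gs unfolding bounded_growth_def by blast
  then obtain K where K: "\<And>g n S. \<lbrakk>g \<in> set gs; n \<notin> Z; finite S; card S \<le> l * s n\<rbrakk> \<Longrightarrow>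
      card (values_on (m, g) S) \<le> K g * s n"
    by metis
  define l' where "l' = (\<Sum>g\<in>set gs. K g)"
  obtain K' where K': "\<And>n T. \<lbrakk>n \<notin> Z; finite T; card T \<le> l' * s n\<rbrakk> \<Longrightarrow>
      card (values_on (length gs, f) T) \<le> K' * s n"
    using f unfolding bounded_growth_def by metis
  have "card (values_on (compose_op m f gs) S) \<le> K' * s n"
    if S: "n \<notin> Z" "finite S" "card S \<le> l * s n" for n S
  proof -
    let ?T = "\<Union>g\<in>set gs. values_on (m, g) S"
    have fin: "finite ?T"
      using S finite_values_on by blast
    have "card ?T \<le> (\<Sum>g\<in>set gs. card (values_on (m, g) S))"
      by (rule card_UN_le) simp
    also have "\<dots> \<le> (\<Sum>g\<in>set gs. K g * s n)"
      using K S by (intro sum_mono) blast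
    also have "\<dots> = l' * s n"
      unfolding l'_def by (simp add: sum_distrib_right)
    finally have "card (values_on (length gs, f) ?T) \<le> K' * s n"
      using K' S fin by blast
    moreover have "card (values_on (compose_op m f gs) S) \<le> card (values_on (length gs, f) ?T)"
      by (rule card_mono[OF finite_values_on[OF fin] values_on_compose_op])
    ultimately show ?thesis by linarith
  qed
  then show "\<exists>K. \<forall>n S. n \<notin> Z \<longrightarrow> finite S \<longrightarrow> card S \<le> l * s n \<longrightarrow>
      card (values_on (compose_op m f gs) S) \<le> K * s n"
    by blast
qed

lemma operation_iff: "(n, f) \<in> operations \<longleftrightarrow> 0 < n \<and> f \<in> extensional (tuples n)"
  unfolding operations_def operations_of_arity_def by (auto simp: PiE_def)

text \<open>
  Closure under unions is what provides one exceptional set for all the operations that occur in a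
  composition.
\<close>

lemma clone_growth_clone:
  assumes ne: "\<Z> \<noteq> {}" and Un: "\<And>Y Z. Y \<in> \<Z> \<Longrightarrow> Z \<in> \<Z> \<Longrightarrow> Y \<union> Z \<in> \<Z>"
  shows "clone (growth_clone s \<Z> :: 'a operation set)"
    and "operations_of_arity 1 \<subseteq> (growth_clone s \<Z> :: 'a operation set)"
proof -
  obtain Z0 where Z0: "Z0 \<in> \<Z>" using ne by blast
  show "operations_of_arity 1 \<subseteq> (growth_clone s \<Z> :: 'a operation set)"
    using Z0 bounded_growth_unary unfolding growth_clone_def operations_def operations_of_arity_def
    by auto
  have common: "\<exists>Z\<in>\<Z>. Z0 \<subseteq> Z \<and> (\<forall>g\<in>set gs. bounded_growth s Z (m, g))"
    if "\<forall>g\<in>set gs. (m, g) \<in> growth_clone s \<Z>" "Z0 \<in> \<Z>"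
    for gs :: "('a list \<Rightarrow> 'a) list" and m Z0
    using that
  proof (induction gs)
    case Nil
    then show ?case by auto
  next
    case (Cons g gs)
    then obtain Z where Z: "Z \<in> \<Z>" "Z0 \<subseteq> Z" "\<forall>g\<in>set gs. bounded_growth s Z (m, g)"
      by auto
    obtain Y where Y: "Y \<in> \<Z>" "bounded_growth s Y (m, g)"
      using Cons.prems unfolding growth_clone_def by auto
    have "bounded_growth s (Y \<union> Z) (m, h)" if "h \<in> set (g # gs)" for h
      using that Y(2) Z(3) by (auto intro: bounded_growth_mono)
    then show ?case
      using Un[OF Y(1) Z(1)] Z(2) by blast
  qed
  show "clone (growth_clone s \<Z> :: 'a operation set)"
    unfolding clone_def
  proof (intro conjI allI impI)
    show "growth_clone s \<Z> \<subseteq> (operations :: 'a operation set)"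
      unfolding growth_clone_def by blast
  next
    fix n i :: nat assume "i < n"
    then have "projection n i \<in> (operations :: 'a operation set)"
      unfolding projection_def operation_iff by auto
    then show "projection n i \<in> (growth_clone s \<Z> :: 'a operation set)"
      using bounded_growth_projection[OF \<open>i < n\<close>] Z0 unfolding growth_clone_def by auto
  next
    fix n m and f :: "'a list \<Rightarrow> 'a" and gs :: "('a list \<Rightarrow> 'a) list"
    assume f: "(n, f) \<in> growth_clone s \<Z>" and n: "length gs = n"
      and gs: "\<forall>g\<in>set gs. (m, g) \<in> growth_clone s \<Z>"
    obtain Y where Y: "Y \<in> \<Z>" "bounded_growth s Y (length gs, f)"
      using f n unfolding growth_clone_def by auto
    obtain Z where Z: "Z \<in> \<Z>" "Y \<subseteq> Z" "\<forall>g\<in>set gs. bounded_growth s Z (m, g)"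
      using common[OF gs Y(1)] by blast
    have "0 < n"
      using f by (simp add: growth_clone_def operation_iff)
    then obtain g where "g \<in> set gs"
      using n by (cases gs) auto
    then have "0 < m"
      using gs by (auto simp: growth_clone_def operation_iff)
    then have "compose_op m f gs \<in> operations"
      unfolding compose_op_def operation_iff by auto
    moreover have "bounded_growth s Z (compose_op m f gs)"
      using bounded_growth_compose_op bounded_growth_mono Y(2) Z(2,3) by blast
    ultimately show "compose_op m f gs \<in> growth_clone s \<Z>"
      using Z(1) unfolding growth_clone_def by blast
  qed
qed

section \<open>Operations that grow fast at prescribed scales\<close>

text \<open>
  The edge sets \<open>E n\<close> witness fast growth at the scale \<open>card (V n)\<close> (assumption \<open>dense\<close>) but are invisible
  at every other scale \<open>card (V m)\<close>: for \<open>n < m\<close> there are too few edges in total (\<open>earlier\<close>), and for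
  \<open>m < n\<close> a set of that scale, even when enlarged by a factor \<open>l\<close>, spans few of them (\<open>later\<close>). As
  the factor must be arbitrary but \<open>E n\<close> is only one finite graph, \<open>later\<close> is restricted to \<open>l \<le> n\<close>;
  this leaves out finitely many \<open>n\<close> for each \<open>l\<close>.
\<close>

locale sparse_blocks =
  fixes V :: "nat \<Rightarrow> nat set" and E :: "nat \<Rightarrow> (nat \<times> nat) set"
  assumes finite_V: "finite (V n)" and V_nonempty: "0 < card (V n)"
    and E_subset: "E n \<subseteq> V n \<times> V n"
    and dense: "n * card (V n) \<le> card (E n)"
    and earlier: "(\<Sum>k<m. card (E k)) \<le> card (V m)"
    and later: "\<lbrakk>l \<le> n; m < n; finite S; card S \<le> l * card (V m)\<rbrakk> \<Longrightarrow>
      card (E n \<inter> S \<times> S) \<le> 2 * card S"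

lemma exists_sparse_blocks: "\<exists>V E. sparse_blocks V E"
proof -
  have "\<forall>b. \<exists>(V :: nat set) E. regular_graph b V E \<and> locally_sparse b E"
    using exists_regular_locally_sparse by blast
  then obtain V0 :: "nat \<Rightarrow> nat set" and E0
    where G: "\<And>b. regular_graph b (V0 b) (E0 b)" "\<And>b. locally_sparse b (E0 b)"
    by metis
  \<comment> \<open>\<open>b n\<close> is both the degree and the sparsity bound of the \<open>n\<close>th graph; it is at least the number of edges of
    all earlier graphs together, and \<open>n\<close> times each of their numbers of vertices.\<close>
  define b where
    "b = rec_nat 0 (\<lambda>n x. Suc n * (x + card (V0 x) + card (E0 x) + 1))"
  define V where "V n = V0 (b n)" for n
  define E where "E n = E0 (b n)" for n
  have b_Suc: "b (Suc n) = Suc n * (b n + card (V n) + card (E n) + 1)" for n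
    unfolding b_def V_def E_def by simp
  have reg: "regular_graph (b n) (V n) (E n)" and sparse: "locally_sparse (b n) (E n)" for n
    using G unfolding V_def E_def by auto
  have b_le_V: "b n \<le> card (V n)" for n
    using degree_le_card_vertices[OF reg] by blast
  have n_le_b: "n \<le> b n" for n
    by (cases n) (auto simp: b_Suc)
  have sum_le_b: "(\<Sum>k<m. card (E k)) \<le> b m" for m
  proof (induction m)
    case (Suc m)
    have "b m + card (E m) \<le> b (Suc m)"
      unfolding b_Suc by simp
    then show ?case using Suc by simp
  qed simp
  have n_V_le_b: "n * card (V m) \<le> b n" if "m < n" for m n
    using that
  proof (induction n)
    case (Suc n)
    have "card (V m) \<le> b n + card (V n)"
    proof (cases "m = n")
      case False
      then have "m < n" using Suc.prems by simp
      then have "n * card (V m) \<le> b n" "1 \<le> n" using Suc.IH by auto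
      then show ?thesis
        by (metis le_trans mult_le_mono1 nat_mult_1 trans_le_add1)
    qed simp
    then have "card (V m) \<le> b n + card (V n) + card (E n) + 1" by simp
    then show ?case unfolding b_Suc by (rule mult_le_mono2)
  qed simp
  have "sparse_blocks V E"
  proof
    fix n m l :: nat and S :: "nat set"
    show "finite (V n)" "E n \<subseteq> V n \<times> V n"
      using reg unfolding regular_graph_def by auto
    show "0 < card (V n)"
      using degree_le_card_vertices[OF reg] by blast
    show "n * card (V n) \<le> card (E n)"
      using card_edges_regular_graph(2)[OF reg] n_le_b by simp
    show "(\<Sum>k<m. card (E k)) \<le> card (V m)"
      using sum_le_b b_le_V le_trans by blast
    assume "l \<le> n" "m < n" and S: "finite S" "card S \<le> l * card (V m)"
    then have "card S \<le> b n"
      using n_V_le_b[OF \<open>m < n\<close>] mult_le_mono1[OF \<open>l \<le> n\<close>, of "card (V m)"] by linarith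
    then show "card (E n \<inter> S \<times> S) \<le> 2 * card S"
      using locally_sparseD[OF sparse S(1)] by (cases "S = {}") force+
  qed
  then show ?thesis by blast
qed

context sparse_blocks
begin

text \<open>
  The disjoint union of the graphs \<open>E n\<close> for \<open>n \<in> Z\<close>, with vertices coded as numbers.
\<close>

definition edges :: "nat set \<Rightarrow> (nat \<times> nat) set" where
  "edges Z = {(prod_encode (n, v), prod_encode (n, w)) | n v w. n \<in> Z \<and> (v, w) \<in> E n}"

text \<open>
  Injective on the edges and constant elsewhere: the number of values on \<open>S\<close> is, up to one, the number
  of edges spanned by \<open>S\<close>.
\<close>

definition edge_op :: "nat set \<Rightarrow> nat operation" where
  "edge_op Z = (2, \<lambda>xs\<in>tuples 2.
     if (xs ! 0, xs ! 1) \<in> edges Z then Suc (prod_encode (xs ! 0, xs ! 1)) else 0)"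

lemma edge_op_operation: "edge_op Z \<in> operations"
  unfolding edge_op_def operation_iff by auto

lemma finite_E: "finite (E n)"
  using finite_V E_subset by (meson finite_SigmaI finite_subset)

lemma card_values_on_edge_op_le:
  assumes "finite S"
  shows "card (values_on (edge_op Z) S) \<le> Suc (card (edges Z \<inter> S \<times> S))"
proof -
  let ?A = "edges Z \<inter> S \<times> S"
  have fin: "finite ?A" using assms by blast
  have "values_on (edge_op Z) S \<subseteq> insert 0 ((\<lambda>e. Suc (prod_encode e)) ` ?A)"
    unfolding values_on_def edge_op_def tuples_def
    by (auto simp: numeral_2_eq_2 length_Suc_conv)
  then have "card (values_on (edge_op Z) S) \<le> card (insert 0 ((\<lambda>e. Suc (prod_encode e)) ` ?A))"
    by (rule card_mono[rotated]) (use fin in blast)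
  also have "\<dots> \<le> Suc (card ((\<lambda>e. Suc (prod_encode e)) ` ?A))"
    by (rule card_insert_le_m1) simp_all
  also have "\<dots> \<le> Suc (card ?A)"
    using card_image_le[OF fin] by simp
  finally show ?thesis .
qed

lemma card_values_on_edge_op_ge:
  assumes "finite S"
  shows "card (edges Z \<inter> S \<times> S) \<le> card (values_on (edge_op Z) S)"
proof (rule card_inj_on_le[of "\<lambda>e. Suc (prod_encode e)"])
  show "inj_on (\<lambda>e. Suc (prod_encode e)) (edges Z \<inter> S \<times> S)"
    by (simp add: inj_on_def)
  show "(\<lambda>e. Suc (prod_encode e)) ` (edges Z \<inter> S \<times> S) \<subseteq> values_on (edge_op Z) S"
  proof
    fix y assume "y \<in> (\<lambda>e. Suc (prod_encode e)) ` (edges Z \<inter> S \<times> S)"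
    then obtain a c where "(a, c) \<in> edges Z" "a \<in> S" "c \<in> S" "y = Suc (prod_encode (a, c))"
      by auto
    then show "y \<in> values_on (edge_op Z) S"
      unfolding values_on_def edge_op_def tuples_def by (intro image_eqI[of _ _ "[a, c]"]) auto
  qed
  show "finite (values_on (edge_op Z) S)"
    using assms by (rule finite_values_on)
qed

text \<open>
  The set \<open>S\<close> has the scale of the block \<open>m\<close>, which does not contribute. The blocks before \<open>m\<close> are
  counted in full, and so are the blocks before \<open>l\<close>, for which \<open>later\<close> says nothing; every other block
  contributes at most twice the number of vertices of \<open>S\<close> that lie in it.
\<close>

lemma edges_few:
  assumes m: "m \<notin> Z" and S: "finite S" "card S \<le> l * card (V m)"
  shows "card (edges Z \<inter> S \<times> S) \<le>
    (\<Sum>k<m. card (E k)) + (\<Sum>k<l. card (E k)) + 2 * card S"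
proof -
  define slice where "slice n = {v. prod_encode (n, v) \<in> S}" for n
  define N where "N = fst ` prod_decode ` S"
  have N: "finite N" using S unfolding N_def by blast
  have SN: "Sigma N slice = prod_decode ` S"
  proof -
    have "x \<in> Sigma N slice \<longleftrightarrow> prod_encode x \<in> S" for x
      unfolding N_def slice_def by (cases x) (force simp: image_iff)
    then show ?thesis
      by (metis bij_betw_imp_surj_on bij_prod_decode image_eqI inj_image_mem_iff
          inj_prod_decode prod_encode_inverse subsetI subset_antisym)
  qed
  have fin_slice: "finite (slice n)" for n
    unfolding slice_def using finite_vimageI[OF S(1), of "\<lambda>v. prod_encode (n, v)"]
    by (simp add: vimage_def inj_on_def)
  have card_S: "(\<Sum>n\<in>N. card (slice n)) = card S"
  proof -
    have "(\<Sum>n\<in>N. card (slice n)) = card (Sigma N slice)"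
      using N fin_slice by (simp add: card_SigmaI)
    also have "\<dots> = card S"
      unfolding SN by (rule card_image) (rule inj_on_subset[OF inj_prod_decode subset_UNIV])
    finally show ?thesis .
  qed
  let ?e = "\<lambda>n. E n \<inter> slice n \<times> slice n"
  have "edges Z \<inter> S \<times> S \<subseteq>
      (\<lambda>(n, (v, w)). (prod_encode (n, v), prod_encode (n, w))) ` Sigma (N \<inter> Z) ?e"
  proof
    fix x assume "x \<in> edges Z \<inter> S \<times> S"
    then obtain n v w where x: "x = (prod_encode (n, v), prod_encode (n, w))" "n \<in> Z"
        "(v, w) \<in> E n" "v \<in> slice n" "w \<in> slice n"
      unfolding edges_def slice_def by auto
    then have "n \<in> N"
      using SN unfolding N_def slice_def by force
    then show "x \<in> (\<lambda>(n, (v, w)). (prod_encode (n, v), prod_encode (n, w))) ` Sigma (N \<inter> Z) ?e"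
      using x by (intro image_eqI[of _ _ "(n, (v, w))"]) auto
  qed
  then have "card (edges Z \<inter> S \<times> S) \<le> card (Sigma (N \<inter> Z) ?e)"
    using N fin_slice by (intro surj_card_le) auto
  also have "\<dots> = (\<Sum>n\<in>N \<inter> Z. card (?e n))"
    using N fin_slice by simp
  also have "\<dots> \<le> (\<Sum>n\<in>N \<inter> Z. (if n < m then card (E n) else 0) +
      (if n < l then card (E n) else 0) + 2 * card (slice n))"
  proof (rule sum_mono)
    fix n assume n: "n \<in> N \<inter> Z"
    show "card (?e n) \<le> (if n < m then card (E n) else 0) +
        (if n < l then card (E n) else 0) + 2 * card (slice n)"
    proof (cases "n < m \<or> n < l")
      case True
      moreover have "card (?e n) \<le> card (E n)"
        by (rule card_mono[OF finite_E]) blast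
      ultimately show ?thesis by auto
    next
      case False
      have "card (slice n) \<le> card S"
        using member_le_sum[of n N "\<lambda>n. card (slice n)"] n N card_S by simp
      moreover have "m \<noteq> n" using m n by blast
      ultimately have "card (?e n) \<le> 2 * card (slice n)"
        using False S by (intro later[of l n m] fin_slice) auto
      then show ?thesis by simp
    qed
  qed
  also have "\<dots> \<le> (\<Sum>k<m. card (E k)) + (\<Sum>k<l. card (E k)) + 2 * card S"
  proof -
    have early: "(\<Sum>n\<in>N \<inter> Z. if n < j then card (E n) else 0) \<le> (\<Sum>k<j. card (E k))" for j
    proof -
      have "(\<Sum>n\<in>N \<inter> Z. if n < j then card (E n) else 0) = (\<Sum>n\<in>N \<inter> Z \<inter> {n. n < j}. card (E n))"
        using N by (simp add: sum.inter_restrict)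
      also have "\<dots> \<le> (\<Sum>k<j. card (E k))"
        by (rule sum_mono2) auto
      finally show ?thesis .
    qed
    have "(\<Sum>n\<in>N \<inter> Z. 2 * card (slice n)) \<le> (\<Sum>n\<in>N. 2 * card (slice n))"
      using N by (intro sum_mono2) auto
    also have "\<dots> = 2 * card S"
      using card_S by (simp flip: sum_distrib_left)
    finally show ?thesis
      using early[of m] early[of l] by (simp only: sum.distrib)
  qed
  finally show ?thesis .
qed

lemma bounded_growth_edge_op: "bounded_growth (\<lambda>n. card (V n)) Z (edge_op Z)"
  unfolding bounded_growth_def
proof (intro allI exI impI)
  fix l m and S :: "nat set"
  assume m: "m \<notin> Z" and S: "finite S" "card S \<le> l * card (V m)"
  let ?c = "\<Sum>k<l. card (E k)"
  have "card (values_on (edge_op Z) S) \<le> 1 + (card (V m) + ?c + 2 * (l * card (V m)))"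
    using card_values_on_edge_op_le[OF S(1), of Z] edges_few[OF m S] earlier[of m] S(2)
    by linarith
  also have "\<dots> \<le> (2 + ?c + 2 * l) * card (V m)"
  proof -
    have "1 + ?c \<le> (1 + ?c) * card (V m)"
      using V_nonempty[of m] by (cases "card (V m)") auto
    then show ?thesis by (simp add: algebra_simps)
  qed
  finally show "card (values_on (edge_op Z) S) \<le> (2 + ?c + 2 * l) * card (V m)" .
qed

text \<open>
  For \<open>n \<in> Y - Z\<close> the set of all vertices of the block \<open>n\<close> has size \<open>card (V n)\<close>, but \<open>edge_op Y\<close> takes at
  least \<open>n * card (V n)\<close> values on it.
\<close>

lemma unbounded_growth_edge_op:
  assumes "infinite (Y - Z)"
  shows "\<not> bounded_growth (\<lambda>n. card (V n)) Z (edge_op Y)"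
proof
  assume "bounded_growth (\<lambda>n. card (V n)) Z (edge_op Y)"
  then have "\<exists>K. \<forall>n S. n \<notin> Z \<longrightarrow> finite S \<longrightarrow> card S \<le> 1 * card (V n) \<longrightarrow>
      card (values_on (edge_op Y) S) \<le> K * card (V n)"
    unfolding bounded_growth_def by (rule spec)
  then obtain K where K: "\<And>n S. \<lbrakk>n \<notin> Z; finite S; card S \<le> card (V n)\<rbrakk> \<Longrightarrow>
      card (values_on (edge_op Y) S) \<le> K * card (V n)"
    by auto
  obtain n where n: "K < n" "n \<in> Y - Z"
    using assms unfolding infinite_nat_iff_unbounded by blast
  let ?c = "\<lambda>v. prod_encode (n, v)"
  let ?S = "?c ` V n"
  have S: "finite ?S" "card ?S \<le> card (V n)"
    using finite_V card_image_le by blast+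
  have "card (E n) \<le> card (edges Y \<inter> ?S \<times> ?S)"
  proof (rule card_inj_on_le)
    show "inj_on (map_prod ?c ?c) (E n)"
      by (auto simp: inj_on_def)
    show "map_prod ?c ?c ` E n \<subseteq> edges Y \<inter> ?S \<times> ?S"
      using n E_subset[of n] unfolding edges_def by auto
    show "finite (edges Y \<inter> ?S \<times> ?S)"
      using S by blast
  qed
  also have "\<dots> \<le> card (values_on (edge_op Y) ?S)"
    by (rule card_values_on_edge_op_ge[OF S(1)])
  also have "\<dots> \<le> K * card (V n)"
    using K S n by blast
  finally have "n * card (V n) \<le> K * card (V n)"
    using dense[of n] by linarith
  then show False
    using V_nonempty[of n] n by simp
qed

end

section \<open>Almost disjoint families and the number of operations\<close>

text \<open>
  The branch of the binary tree given by the characteristic function of \<open>r\<close>, with nodes coded as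
  numbers. The branches form an almost disjoint family, so no branch is covered, even up to a finite
  set, by finitely many others.
\<close>

definition branch :: "nat set \<Rightarrow> nat set" where
  "branch r = (\<lambda>n. prod_encode (n, set_encode (r \<inter> {..<n}))) ` UNIV"

lemma infinite_branch: "infinite (branch r)"
  unfolding branch_def by (rule range_inj_infinite) (simp add: inj_on_def)

lemma finite_branch_Int:
  assumes "q \<noteq> r"
  shows "finite (branch q \<inter> branch r)"
proof -
  obtain k where k: "k \<in> q \<longleftrightarrow> k \<notin> r" using assms by blast
  have "branch q \<inter> branch r \<subseteq> (\<lambda>n. prod_encode (n, set_encode (q \<inter> {..<n}))) ` {..k}"
  proof
    fix x assume "x \<in> branch q \<inter> branch r"
    then obtain n where x: "x = prod_encode (n, set_encode (q \<inter> {..<n}))"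
        and "set_encode (q \<inter> {..<n}) = set_encode (r \<inter> {..<n})"
      unfolding branch_def by auto
    then have "q \<inter> {..<n} = r \<inter> {..<n}"
      by (simp add: set_encode_eq)
    then have "n \<le> k"
      using k by (metis IntD1 IntI lessThan_iff not_le)
    then show "x \<in> (\<lambda>n. prod_encode (n, set_encode (q \<inter> {..<n}))) ` {..k}"
      using x by blast
  qed
  then show ?thesis
    by (rule finite_subset) blast
qed

lemma infinite_branch_minus_Union:
  assumes "finite F" and "r \<notin> F"
  shows "infinite (branch r - (\<Union>q\<in>F. branch q))"
proof -
  have "finite (branch r \<inter> branch q)" if "q \<in> F" for q
    using that assms(2) by (intro finite_branch_Int) blast
  then have "finite (\<Union>q\<in>F. branch r \<inter> branch q)"
    using assms(1) by blast
  moreover have "branch r - (\<Union>q\<in>F. branch q) = branch r - (\<Union>q\<in>F. branch r \<inter> branch q)"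
    by blast
  ultimately show ?thesis
    using Diff_infinite_finite[OF _ infinite_branch] by metis
qed

lemma lepoll_Pow_mono:
  assumes "A \<lesssim> B"
  shows "Pow A \<lesssim> Pow B"
proof -
  obtain f where f: "inj_on f A" "f ` A \<subseteq> B"
    using assms unfolding lepoll_def by blast
  have "inj_on ((`) f) (Pow A)"
    using f(1) by (rule inj_on_image_Pow)
  moreover have "(`) f ` Pow A \<subseteq> Pow B"
    using f(2) by blast
  ultimately show ?thesis unfolding lepoll_def by blast
qed

text \<open>
  An operation is determined by its arity and its graph, coded as a set of numbers.
\<close>

lemma operations_lepoll: "(UNIV :: nat operation set) \<lesssim> Pow (UNIV :: nat set)"
proof -
  let ?graph = "\<lambda>p :: nat operation.
    range (\<lambda>xs. prod_encode (fst p, prod_encode (list_encode xs, snd p xs)))"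
  have "inj ?graph"
  proof (rule injI)
    fix p q :: "nat operation" assume eq: "?graph p = ?graph q"
    have "fst p = fst q \<and> snd p xs = snd q xs" for xs
    proof -
      have "prod_encode (fst p, prod_encode (list_encode xs, snd p xs)) \<in> ?graph q"
        unfolding eq[symmetric] by blast
      then show ?thesis by (auto simp: list_encode_eq)
    qed
    then show "p = q" by (auto simp: prod_eq_iff)
  qed
  then show ?thesis unfolding lepoll_def by auto
qed

section \<open>The number of clones containing all unary operations\<close>

theorem theorem1p1:
  "{C :: nat operation set. clone C \<and> operations_of_arity 1 \<subseteq> C} \<approx> Pow (Pow (UNIV :: nat set))"
proof (rule lepoll_antisym)
  show "{C :: nat operation set. clone C \<and> operations_of_arity 1 \<subseteq> C} \<lesssim> Pow (Pow (UNIV :: nat set))"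
    using lepoll_trans[OF subset_imp_lepoll lepoll_Pow_mono[OF operations_lepoll]] by blast
next
  obtain V E where "sparse_blocks V E"
    using exists_sparse_blocks by blast
  then interpret sparse_blocks V E .
  let ?s = "\<lambda>n. card (V n)"
  \<comment> \<open>The clone \<open>C J\<close> ignores the scales in finitely many branches with index in \<open>J\<close>; the operation
    \<open>edge_op (branch r)\<close> decides whether \<open>r\<close> is in \<open>J\<close>.\<close>
  define \<Z> where "\<Z> J = {\<Union>q\<in>F. branch q | F. finite F \<and> F \<subseteq> J}" for J
  define C where "C J = (growth_clone ?s (\<Z> J) :: nat operation set)" for J
  have ne: "\<Z> J \<noteq> {}" for J
    unfolding \<Z>_def by blast
  have Un: "Y \<union> Z \<in> \<Z> J" if YZ: "Y \<in> \<Z> J" "Z \<in> \<Z> J" for J Y Z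
  proof -
    obtain F G where "finite F" "F \<subseteq> J" "finite G" "G \<subseteq> J"
        and eq: "Y = (\<Union>q\<in>F. branch q)" "Z = (\<Union>q\<in>G. branch q)"
      using YZ unfolding \<Z>_def by blast
    then have "finite (F \<union> G)" "F \<union> G \<subseteq> J" "Y \<union> Z = (\<Union>q\<in>F \<union> G. branch q)"
      by auto
    then show ?thesis unfolding \<Z>_def by blast
  qed
  have clones: "clone (C J)" "operations_of_arity 1 \<subseteq> C J" for J
    unfolding C_def using clone_growth_clone[OF ne Un] by blast+
  have mem: "edge_op (branch r) \<in> C J \<longleftrightarrow> r \<in> J" for r J
  proof
    assume "r \<in> J"
    then have "branch r \<in> \<Z> J"
      unfolding \<Z>_def by (intro CollectI exI[of _ "{r}"]) simp
    then show "edge_op (branch r) \<in> C J"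
      using edge_op_operation bounded_growth_edge_op unfolding C_def growth_clone_def by blast
  next
    assume "edge_op (branch r) \<in> C J"
    then obtain F where F: "finite F" "F \<subseteq> J"
        "bounded_growth ?s (\<Union>q\<in>F. branch q) (edge_op (branch r))"
      unfolding C_def growth_clone_def \<Z>_def by blast
    then have "r \<in> F"
      using unbounded_growth_edge_op infinite_branch_minus_Union by blast
    then show "r \<in> J" using F by blast
  qed
  have "inj C"
  proof (rule injI)
    fix I J assume "C I = C J"
    then show "I = J" using mem by blast
  qed
  then show "Pow (Pow (UNIV :: nat set)) \<lesssim> {C :: nat operation set. clone C \<and> operations_of_arity 1 \<subseteq> C}"
    unfolding lepoll_def using clones by (intro exI[of _ C]) auto
qed

end
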